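(* Let $M$ be a differentiable manifold with an affine connection $\nabla$, and let $\Gamma$ be a nonempty family of complete $\mathcal{C}^{\infty}$ vector fields on $M$ such that every $X\in\Gamma$ satisfies $\nabla_X X=c_X X$ for some smooth function $c_X:M\to\mathbb{R}$. Assume that every $X\in\Gamma$ admits exactly one attractor $a\in M$, and suppose also that every trajectory of $X$ is a minimal geodesic between each of its points and the attractor $a$. If $$E=\{a\in M \mid a \text{ is the attractor of some } X\in\Gamma\}$$ is closed and geodesically convex, then $E$ is the invariant control set for $\Gamma$.
   Context: Attractor: for a complete smooth vector field $X$ on $M$ with flow $X_t$, a point $a\in M$ is an attractor (attractor fixed point) of $X$ if $X$ vanishes at $a$ and $\lim_{t\to\infty}X_t(x)=a$ for every initial state $x\in M$. Geodesic convexity: a subset $C\subset M$ is geodesically convex if for all $p,q\in C$ the minimal geodesic segment joining $p$ and $q$ (every such segment, if there are several) is contained in $C$. Geodesics are those of $\nabla$ (up to reparametrization), and "minimal" is used in the usual sense of a geodesic segment of shortest length among curves joining its endpoints, for a Riemannian metric on $M$ underlying the notion of length. Trajectories and orbits: a trajectory of $\Gamma$ is a continuous curve $\gamma:[0,T]\to M$, $T\ge 0$, for which there is a finite partition of $[0,T]$ such that on each subinterval $\gamma$ is an integral curve of some element of $\Gamma$ (forward in time). The positive orbit $\mathcal{O}^{+}(x)$ of $x\in M$ is the set of endpoints of trajectories of $\Gamma$ starting at $x$. Invariant control set: a nonempty set $C\subset M$ is an invariant control set of $\Gamma$ if (i) for every $x\in C$ there is a trajectory of $\Gamma$, defined for all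 $t\ge 0$ (a concatenation of forward integral curves of elements of $\Gamma$), starting at $x$ and contained in $C$ for all $t\ge 0$; (ii) $\mathrm{cl}\,C=\mathrm{cl}\,\mathcal{O}^{+}(x)$ for every $x\in C$; (iii) $C$ is maximal with these properties: if $C'\supset C$ satisfies (i) and (ii) then $C'=C$. *)

theory Defs
  imports "HOL-Analysis.Analysis"
begin

text \<open>
  \<open>Ck_on\<close> and \<open>smooth_on\<close> are meant for open sets: they use the two-sided
  Frechet derivative at every point of the set.
\<close>

fun Ck_on :: "nat \<Rightarrow> 'a::real_normed_vector set \<Rightarrow> ('a \<Rightarrow> 'b::real_normed_vector) \<Rightarrow> bool" where
  "Ck_on 0 S f \<longleftrightarrow> continuous_on S f"
| "Ck_on (Suc n) S f \<longleftrightarrow>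
     (\<forall>x\<in>S. f differentiable (at x)) \<and>
     (\<forall>v. Ck_on n S (\<lambda>x. frechet_derivative f (at x) v))"

definition smooth_on :: "'a::real_normed_vector set \<Rightarrow> ('a \<Rightarrow> 'b::real_normed_vector) \<Rightarrow> bool" where
  "smooth_on S f \<longleftrightarrow> (\<forall>n. Ck_on n S f)"

text \<open>
  The manifold is the whole type \<open>'m\<close>, whose type classes supply the topology; its smooth
  structure is given by an atlas of charts \<open>(U, \<phi>)\<close> with values in the model space \<open>'e\<close>.
\<close>

type_synonym ('m, 'e) atlas = "('m set \<times> ('m \<Rightarrow> 'e)) set"

definition chart :: "'m::topological_space set \<Rightarrow> ('m \<Rightarrow> 'e::euclidean_space) \<Rightarrow> bool" where
  "chart U \<phi> \<longleftrightarrow> open U \<and> open (\<phi> ` U) \<and> homeomorphism U (\<phi> ` U) \<phi> (inv_into U \<phi>)"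

definition smooth_manifold ::
    "('m::{t2_space, second_countable_topology}, 'e::euclidean_space) atlas \<Rightarrow> bool" where
  "smooth_manifold A \<longleftrightarrow>
     (\<forall>(U, \<phi>)\<in>A. chart U \<phi>) \<and>
     (\<Union>(U, \<phi>)\<in>A. U) = UNIV \<and>
     (\<forall>(U, \<phi>)\<in>A. \<forall>(V, \<psi>)\<in>A. smooth_on (\<phi> ` (U \<inter> V)) (\<psi> \<circ> inv_into U \<phi>))"

definition smooth_fun :: "('m, 'e::euclidean_space) atlas \<Rightarrow> ('m \<Rightarrow> real) \<Rightarrow> bool" where
  "smooth_fun A f \<longleftrightarrow> (\<forall>(U, \<phi>)\<in>A. smooth_on (\<phi> ` U) (f \<circ> inv_into U \<phi>))"

text \<open>
  Tangent vectors at \<open>p\<close> are derivations at \<open>p\<close> of the algebra of smooth functions, and smooth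
  vector fields are derivations of that algebra. Both are required to be zero on functions that
  are not smooth, so that equality in HOL is equality of vectors and of fields.
\<close>

type_synonym 'm tvec = "('m \<Rightarrow> real) \<Rightarrow> real"
type_synonym 'm vfield = "('m \<Rightarrow> real) \<Rightarrow> 'm \<Rightarrow> real"

definition tangent_space :: "('m, 'e::euclidean_space) atlas \<Rightarrow> 'm \<Rightarrow> 'm tvec set" where
  "tangent_space A p = {v.
     (\<forall>f h. smooth_fun A f \<longrightarrow> smooth_fun A h \<longrightarrow> v (\<lambda>x. f x + h x) = v f + v h) \<and>
     (\<forall>r f. smooth_fun A f \<longrightarrow> v (\<lambda>x. r * f x) = r * v f) \<and>
     (\<forall>f h. smooth_fun A f \<longrightarrow> smooth_fun A h \<longrightarrow>
        v (\<lambda>x. f x * h x) = f p * v h + h p * v f) \<and>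
     (\<forall>f. \<not> smooth_fun A f \<longrightarrow> v f = 0)}"

definition at_point :: "'m vfield \<Rightarrow> 'm \<Rightarrow> 'm tvec" where
  "at_point X p = (\<lambda>f. X f p)"

definition vector_field :: "('m, 'e::euclidean_space) atlas \<Rightarrow> 'm vfield \<Rightarrow> bool" where
  "vector_field A X \<longleftrightarrow>
     (\<forall>p. at_point X p \<in> tangent_space A p) \<and>
     (\<forall>f. smooth_fun A f \<longrightarrow> smooth_fun A (X f))"

definition vf_add :: "'m vfield \<Rightarrow> 'm vfield \<Rightarrow> 'm vfield" where
  "vf_add X Y = (\<lambda>f p. X f p + Y f p)"

definition vf_scale :: "('m \<Rightarrow> real) \<Rightarrow> 'm vfield \<Rightarrow> 'm vfield" where
  "vf_scale c X = (\<lambda>f p. c p * X f p)"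

text \<open>
  The derivative is taken within \<open>J\<close>, hence one-sided at the end points of a closed interval.
\<close>

definition integral_curve ::
    "('m, 'e::euclidean_space) atlas \<Rightarrow> 'm vfield \<Rightarrow> real set \<Rightarrow> (real \<Rightarrow> 'm) \<Rightarrow> bool" where
  "integral_curve A X J \<gamma> \<longleftrightarrow>
     (\<forall>t\<in>J. \<forall>f. smooth_fun A f \<longrightarrow>
        ((f \<circ> \<gamma>) has_real_derivative X f (\<gamma> t)) (at t within J))"

text \<open>
  \<open>\<Phi> t x\<close> is the state at time \<open>t\<close> of an integral curve starting at \<open>x\<close>. As integral curves are
  unique, a vector field has at most one global flow; it has one iff it is complete.
\<close>

definition global_flow ::
    "('m, 'e::euclidean_space) atlas \<Rightarrow> 'm vfield \<Rightarrow> (real \<Rightarrow> 'm \<Rightarrow> 'm) \<Rightarrow> bool" where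
  "global_flow A X \<Phi> \<longleftrightarrow>
     (\<forall>x. \<Phi> 0 x = x \<and> integral_curve A X UNIV (\<lambda>t. \<Phi> t x))"

definition complete_vf :: "('m, 'e::euclidean_space) atlas \<Rightarrow> 'm vfield \<Rightarrow> bool" where
  "complete_vf A X \<longleftrightarrow> (\<exists>\<Phi>. global_flow A X \<Phi>)"

definition attractor ::
    "('m::topological_space, 'e::euclidean_space) atlas \<Rightarrow> 'm vfield \<Rightarrow> 'm \<Rightarrow> bool" where
  "attractor A X a \<longleftrightarrow>
     at_point X a = (\<lambda>_. 0) \<and>
     (\<forall>\<Phi>. global_flow A X \<Phi> \<longrightarrow> (\<forall>x. ((\<lambda>t. \<Phi> t x) \<longlongrightarrow> a) at_top))"

definition affine_connection ::
    "('m, 'e::euclidean_space) atlas \<Rightarrow> ('m vfield \<Rightarrow> 'm vfield \<Rightarrow> 'm vfield) \<Rightarrow> bool" where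
  "affine_connection A D \<longleftrightarrow>
     (\<forall>X Y. vector_field A X \<longrightarrow> vector_field A Y \<longrightarrow> vector_field A (D X Y)) \<and>
     (\<forall>X X' Y. vector_field A X \<longrightarrow> vector_field A X' \<longrightarrow> vector_field A Y \<longrightarrow>
        D (vf_add X X') Y = vf_add (D X Y) (D X' Y)) \<and>
     (\<forall>f X Y. smooth_fun A f \<longrightarrow> vector_field A X \<longrightarrow> vector_field A Y \<longrightarrow>
        D (vf_scale f X) Y = vf_scale f (D X Y)) \<and>
     (\<forall>X Y Y'. vector_field A X \<longrightarrow> vector_field A Y \<longrightarrow> vector_field A Y' \<longrightarrow>
        D X (vf_add Y Y') = vf_add (D X Y) (D X Y')) \<and>
     (\<forall>f X Y. smooth_fun A f \<longrightarrow> vector_field A X \<longrightarrow> vector_field A Y \<longrightarrow>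
        D X (vf_scale f Y) = vf_add (vf_scale f (D X Y)) (vf_scale (X f) Y))"

definition riemannian_metric ::
    "('m, 'e::euclidean_space) atlas \<Rightarrow> ('m \<Rightarrow> 'm tvec \<Rightarrow> 'm tvec \<Rightarrow> real) \<Rightarrow> bool" where
  "riemannian_metric A g \<longleftrightarrow>
     (\<forall>p. \<forall>u\<in>tangent_space A p. \<forall>v\<in>tangent_space A p. g p u v = g p v u) \<and>
     (\<forall>p. \<forall>u\<in>tangent_space A p. \<forall>v\<in>tangent_space A p. \<forall>w\<in>tangent_space A p.
        g p (\<lambda>f. u f + v f) w = g p u w + g p v w) \<and>
     (\<forall>p r. \<forall>u\<in>tangent_space A p. \<forall>w\<in>tangent_space A p.
        g p (\<lambda>f. r * u f) w = r * g p u w) \<and>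
     (\<forall>p. \<forall>u\<in>tangent_space A p. u \<noteq> (\<lambda>_. 0) \<longrightarrow> g p u u > 0) \<and>
     (\<forall>X Y. vector_field A X \<longrightarrow> vector_field A Y \<longrightarrow>
        smooth_fun A (\<lambda>p. g p (at_point X p) (at_point Y p)))"

definition velocity ::
    "('m, 'e::euclidean_space) atlas \<Rightarrow> (real \<Rightarrow> 'm) \<Rightarrow> real \<Rightarrow> 'm tvec" where
  "velocity A \<gamma> t = (\<lambda>f. if smooth_fun A f then deriv (f \<circ> \<gamma>) t else 0)"

text \<open>
  Continuous curves on \<open>[0, 1]\<close> that are continuously differentiable, with one-sided derivatives
  at the break points, on each piece of a finite partition.
\<close>

definition piecewise_C1_curve ::
    "('m::topological_space, 'e::euclidean_space) atlas \<Rightarrow> (real \<Rightarrow> 'm) \<Rightarrow> bool" where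
  "piecewise_C1_curve A \<sigma> \<longleftrightarrow>
     continuous_on {0..1} \<sigma> \<and>
     (\<exists>(N::nat) \<tau>. \<tau> 0 = 0 \<and> \<tau> N = 1 \<and>
        (\<forall>i<N. \<tau> i < \<tau> (Suc i) \<and>
           (\<forall>f. smooth_fun A f \<longrightarrow>
              (\<exists>f'. continuous_on {\<tau> i..\<tau> (Suc i)} f' \<and>
                 (\<forall>t\<in>{\<tau> i..\<tau> (Suc i)}.
                    ((f \<circ> \<sigma>) has_real_derivative f' t) (at t within {\<tau> i..\<tau> (Suc i)}))))))"

text \<open>
  At the finitely many end and break points of a piecewise differentiable curve the velocity may
  be a junk value; this does not affect the integral.
\<close>

definition curve_length ::
    "('m, 'e::euclidean_space) atlas \<Rightarrow> ('m \<Rightarrow> 'm tvec \<Rightarrow> 'm tvec \<Rightarrow> real) \<Rightarrow>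
     (real \<Rightarrow> 'm) \<Rightarrow> ennreal" where
  "curve_length A g \<sigma> =
     (\<integral>\<^sup>+t\<in>{0..1}. ennreal (sqrt (g (\<sigma> t) (velocity A \<sigma> t) (velocity A \<sigma> t))) \<partial>lborel)"

text \<open>
  The covariant derivative along \<open>\<gamma>\<close>, at time \<open>t\<close>, of a field \<open>V\<close> of tangent vectors along \<open>\<gamma>\<close>.
  Near \<open>t\<close> such a field is a combination \<open>\<Sum>i<N. h i s * Y i (\<gamma> s)\<close> of vector fields \<open>Y i\<close>
  (a local frame, cut off by a bump function), and additivity and the product rule give
  \<open>W = \<Sum>i<N. h i' t * Y i + h i t * D Z (Y i)\<close> at \<open>\<gamma> t\<close>. Here \<open>Z\<close> is any vector field with value
  \<open>\<gamma>' t\<close> at \<open>\<gamma> t\<close>; \<open>D Z (Y i)\<close> at \<open>\<gamma> t\<close> depends on \<open>Z\<close> only through this value.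
\<close>

definition has_covariant_derivative ::
    "('m, 'e::euclidean_space) atlas \<Rightarrow> ('m vfield \<Rightarrow> 'm vfield \<Rightarrow> 'm vfield) \<Rightarrow>
     (real \<Rightarrow> 'm) \<Rightarrow> (real \<Rightarrow> 'm tvec) \<Rightarrow> 'm tvec \<Rightarrow> real \<Rightarrow> bool" where
  "has_covariant_derivative A D \<gamma> V W t \<longleftrightarrow>
     (\<exists>\<epsilon>>0. \<exists>(N::nat) h Y Z.
        vector_field A Z \<and> at_point Z (\<gamma> t) = velocity A \<gamma> t \<and>
        (\<forall>i<N. vector_field A (Y i) \<and> smooth_on {t - \<epsilon><..<t + \<epsilon>} (h i)) \<and>
        (\<forall>s\<in>{t - \<epsilon><..<t + \<epsilon>}. V s = (\<lambda>f. \<Sum>i<N. h i s * Y i f (\<gamma> s))) \<and>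
        W = (\<lambda>f. \<Sum>i<N. deriv (h i) t * Y i f (\<gamma> t) + h i t * D Z (Y i) f (\<gamma> t)))"

definition geodesic_on ::
    "('m::topological_space, 'e::euclidean_space) atlas \<Rightarrow>
     ('m vfield \<Rightarrow> 'm vfield \<Rightarrow> 'm vfield) \<Rightarrow> real set \<Rightarrow> (real \<Rightarrow> 'm) \<Rightarrow> bool" where
  "geodesic_on A D J c \<longleftrightarrow>
     continuous_on J c \<and>
     (\<forall>f. smooth_fun A f \<longrightarrow> smooth_on J (f \<circ> c)) \<and>
     (\<forall>t\<in>J. has_covariant_derivative A D c (velocity A c) (\<lambda>_. 0) t)"

text \<open>
  The geodesic segment joining \<open>p\<close> and \<open>q\<close> is \<open>c ` {0..1}\<close>. Geodesics on a closed interval always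
  extend a little beyond it. Geodesic means geodesic of the connection \<open>D\<close>, affinely parametrized;
  minimal means of least length for \<open>g\<close>.
\<close>

definition minimal_geodesic ::
    "('m::topological_space, 'e::euclidean_space) atlas \<Rightarrow>
     ('m vfield \<Rightarrow> 'm vfield \<Rightarrow> 'm vfield) \<Rightarrow> ('m \<Rightarrow> 'm tvec \<Rightarrow> 'm tvec \<Rightarrow> real) \<Rightarrow>
     'm \<Rightarrow> 'm \<Rightarrow> (real \<Rightarrow> 'm) \<Rightarrow> bool" where
  "minimal_geodesic A D g p q c \<longleftrightarrow>
     (\<exists>\<epsilon>>0. geodesic_on A D {-\<epsilon><..<1 + \<epsilon>} c) \<and> c 0 = p \<and> c 1 = q \<and>
     (\<forall>\<sigma>. piecewise_C1_curve A \<sigma> \<and> \<sigma> 0 = p \<and> \<sigma> 1 = q \<longrightarrow>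
        curve_length A g c \<le> curve_length A g \<sigma>)"

definition geodesically_convex ::
    "('m::topological_space, 'e::euclidean_space) atlas \<Rightarrow>
     ('m vfield \<Rightarrow> 'm vfield \<Rightarrow> 'm vfield) \<Rightarrow> ('m \<Rightarrow> 'm tvec \<Rightarrow> 'm tvec \<Rightarrow> real) \<Rightarrow>
     'm set \<Rightarrow> bool" where
  "geodesically_convex A D g C \<longleftrightarrow>
     (\<forall>p\<in>C. \<forall>q\<in>C. \<forall>c. minimal_geodesic A D g p q c \<longrightarrow> c ` {0..1} \<subseteq> C)"

text \<open>
  The curve \<open>\<gamma>\<close>, from time \<open>s\<close> on, is a minimal geodesic between \<open>\<gamma> s\<close> and its limit point \<open>a\<close>,
  up to the increasing change of parameter \<open>\<theta>\<close> of \<open>[s, \<infinity>)\<close> onto \<open>[0, 1)\<close>. (If \<open>\<gamma>\<close> rests at \<open>a\<close>,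
  then \<open>c\<close> is constant.)
\<close>

definition minimal_geodesic_to ::
    "('m::topological_space, 'e::euclidean_space) atlas \<Rightarrow>
     ('m vfield \<Rightarrow> 'm vfield \<Rightarrow> 'm vfield) \<Rightarrow> ('m \<Rightarrow> 'm tvec \<Rightarrow> 'm tvec \<Rightarrow> real) \<Rightarrow>
     (real \<Rightarrow> 'm) \<Rightarrow> real \<Rightarrow> 'm \<Rightarrow> bool" where
  "minimal_geodesic_to A D g \<gamma> s a \<longleftrightarrow>
     (\<exists>c \<theta>. minimal_geodesic A D g (\<gamma> s) a c \<and>
        continuous_on {s..} \<theta> \<and> strict_mono_on {s..} \<theta> \<and> \<theta> ` {s..} = {0..<1} \<and>
        (\<forall>t\<ge>s. \<gamma> t = c (\<theta> t)))"

definition trajectory ::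
    "('m::topological_space, 'e::euclidean_space) atlas \<Rightarrow> 'm vfield set \<Rightarrow>
     real \<Rightarrow> (real \<Rightarrow> 'm) \<Rightarrow> bool" where
  "trajectory A \<Gamma> T \<gamma> \<longleftrightarrow>
     T \<ge> 0 \<and> continuous_on {0..T} \<gamma> \<and>
     (\<exists>(N::nat) \<tau>. \<tau> 0 = 0 \<and> \<tau> N = T \<and>
        (\<forall>i<N. \<tau> i < \<tau> (Suc i) \<and>
           (\<exists>X\<in>\<Gamma>. integral_curve A X {\<tau> i..\<tau> (Suc i)} \<gamma>)))"

definition positive_orbit ::
    "('m::topological_space, 'e::euclidean_space) atlas \<Rightarrow> 'm vfield set \<Rightarrow> 'm \<Rightarrow> 'm set" where
  "positive_orbit A \<Gamma> x = {\<gamma> T | \<gamma> T. trajectory A \<Gamma> T \<gamma> \<and> \<gamma> 0 = x}"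

definition viable ::
    "('m::topological_space, 'e::euclidean_space) atlas \<Rightarrow> 'm vfield set \<Rightarrow> 'm set \<Rightarrow> bool" where
  "viable A \<Gamma> C \<longleftrightarrow>
     (\<forall>x\<in>C. \<exists>\<gamma>. \<gamma> 0 = x \<and> (\<forall>T\<ge>0. trajectory A \<Gamma> T \<gamma>) \<and> (\<forall>t\<ge>0. \<gamma> t \<in> C))"

definition orbit_dense ::
    "('m::topological_space, 'e::euclidean_space) atlas \<Rightarrow> 'm vfield set \<Rightarrow> 'm set \<Rightarrow> bool" where
  "orbit_dense A \<Gamma> C \<longleftrightarrow> (\<forall>x\<in>C. closure C = closure (positive_orbit A \<Gamma> x))"

definition invariant_control_set ::
    "('m::topological_space, 'e::euclidean_space) atlas \<Rightarrow> 'm vfield set \<Rightarrow> 'm set \<Rightarrow> bool" where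
  "invariant_control_set A \<Gamma> C \<longleftrightarrow>
     C \<noteq> {} \<and> viable A \<Gamma> C \<and> orbit_dense A \<Gamma> C \<and>
     (\<forall>C'. C \<subseteq> C' \<and> viable A \<Gamma> C' \<and> orbit_dense A \<Gamma> C' \<longrightarrow> C' = C)"

end

theory Submission
  imports Defs
begin

text \<open>
  Two facts about a field \<open>X \<in> \<Gamma>\<close> with attractor \<open>a\<close> drive the proof. A forward curve of \<open>X\<close> runs
  along a minimal geodesic that ends at \<open>a\<close>; if it starts in the convex set \<open>E\<close>, both ends of
  that geodesic lie in \<open>E\<close>, so the curve stays in \<open>E\<close> (\<open>minimal_geodesic_to_stays\<close>). Applied piece by piece, this shows that
  positive orbits of points of \<open>E\<close> stay in \<open>E\<close> (\<open>trajectory_stays\<close>). Conversely, the flow of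
  \<open>X\<close> carries every state towards \<open>a\<close>, so \<open>a\<close> is in the closure of every positive orbit
  (\<open>attractor_in_closure_orbit\<close>). As \<open>E\<close> is closed, \<open>closure E = E\<close> is the closure of the
  positive orbit of each of its points.

  The rest is soft. A point of \<open>E\<close> is a zero of some \<open>X \<in> \<Gamma>\<close>, so resting there is a trajectory that
  never leaves \<open>E\<close>. And if \<open>C' \<supseteq> E\<close> is also contained in the orbit closures of its points, then
  looking at a point of \<open>E\<close> gives \<open>C' \<subseteq> closure E = E\<close>.

  The hypothesis on minimal geodesics speaks of integral curves defined for all times, whereas the
  pieces of a trajectory live on compact intervals. Completeness bridges this gap: gluing pieces of
  the flow to the two ends of such a piece extends it to the whole line
  (\<open>integral_curve_extend\<close>).
\<close>

section \<open>Gluing and extending integral curves\<close>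

lemma integral_curve_subset:
  assumes "integral_curve A X J \<gamma>" and "I \<subseteq> J"
  shows "integral_curve A X I \<gamma>"
  using assms unfolding integral_curve_def by (meson DERIV_subset subsetD)

lemma integral_curve_const:
  assumes "at_point X a = (\<lambda>_. 0)"
  shows "integral_curve A X J (\<lambda>_. a)"
proof -
  have "X f a = 0" for f
    using assms by (simp add: at_point_def fun_eq_iff)
  then show ?thesis
    by (simp add: integral_curve_def o_def)
qed

text \<open>
  At a common time of both curves the two one-sided difference quotients have the same limit,
  because both derivatives are the value of \<open>X\<close> at the same point. Elsewhere closedness ensures
  that only one of the curves is seen near the given time.
\<close>

lemma integral_curve_glue:
  assumes \<alpha>: "integral_curve A X S \<alpha>" and \<beta>: "integral_curve A X T \<beta>"
    and "closed S" and "closed T"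
    and agree: "\<And>t. t \<in> S \<Longrightarrow> t \<in> T \<Longrightarrow> \<alpha> t = \<beta> t"
  shows "integral_curve A X (S \<union> T) (\<lambda>t. if t \<in> S then \<alpha> t else \<beta> t)"
proof -
  define \<gamma> where "\<gamma> = (\<lambda>t. if t \<in> S then \<alpha> t else \<beta> t)"
  have \<gamma>S: "\<gamma> t = \<alpha> t" if "t \<in> S" for t
    using that by (simp add: \<gamma>_def)
  have \<gamma>T: "\<gamma> t = \<beta> t" if "t \<in> T" for t
    using that agree by (simp add: \<gamma>_def)
  have deriv: "((f \<circ> \<gamma>) has_real_derivative X f (\<gamma> t)) (at t within R)"
    if "integral_curve A X R \<rho>" "closed R" "\<And>u. u \<in> R \<Longrightarrow> \<gamma> u = \<rho> u" "smooth_fun A f" for R \<rho> f t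
  proof (cases "t \<in> R")
    case True
    then have "((f \<circ> \<rho>) has_real_derivative X f (\<gamma> t)) (at t within R)"
      using that by (simp add: integral_curve_def)
    then show ?thesis
      by (rule has_field_derivative_transform_within[OF _ zero_less_one True]) (simp add: that)
  next
    case False
    \<comment> \<open>Away from the closed set \<open>R\<close> the limit is taken along the trivial filter, so it holds vacuously.\<close>
    then have "at t within R = bot"
      using \<open>closed R\<close> by (meson closed_limpt trivial_limit_within)
    then show ?thesis
      by (simp add: has_field_derivative_iff)
  qed
  have "((f \<circ> \<gamma>) has_real_derivative X f (\<gamma> t)) (at t within S \<union> T)" if "smooth_fun A f" for f t
    using deriv[OF \<alpha> \<open>closed S\<close> \<gamma>S \<open>smooth_fun A f\<close>] deriv[OF \<beta> \<open>closed T\<close> \<gamma>T \<open>smooth_fun A f\<close>]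
    unfolding has_field_derivative_iff by (simp add: at_within_union filterlim_sup)
  then show ?thesis
    unfolding integral_curve_def \<gamma>_def[symmetric] by blast
qed

lemma integral_curve_flow:
  assumes "global_flow A X \<Phi>"
  shows "integral_curve A X UNIV (\<lambda>t. \<Phi> (t - s) x)"
  unfolding integral_curve_def
proof (intro ballI allI impI)
  fix t f assume "smooth_fun A f"
  then have "((\<lambda>u. f (\<Phi> u x)) has_real_derivative X f (\<Phi> (t - s) x)) (at (t + - s))"
    using assms by (simp add: global_flow_def integral_curve_def o_def)
  then show "((f \<circ> (\<lambda>u. \<Phi> (u - s) x)) has_real_derivative X f (\<Phi> (t - s) x)) (at t)"
    unfolding DERIV_shift by (simp add: o_def)
qed

lemma integral_curve_extend:
  assumes "complete_vf A X" and \<gamma>: "integral_curve A X {s..t} \<gamma>" and "s \<le> t"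
  obtains \<delta> where "integral_curve A X UNIV \<delta>" and "\<And>u. u \<in> {s..t} \<Longrightarrow> \<delta> u = \<gamma> u"
proof -
  obtain \<Phi> where \<Phi>: "global_flow A X \<Phi>"
    using assms by (auto simp: complete_vf_def)
  then have start: "\<Phi> 0 x = x" for x
    by (simp add: global_flow_def)
  note flow = integral_curve_subset[OF integral_curve_flow[OF \<Phi>] subset_UNIV]
  define \<alpha> where "\<alpha> = (\<lambda>u. if u \<in> {s..t} then \<gamma> u else \<Phi> (u - t) (\<gamma> t))"
  have "integral_curve A X ({s..t} \<union> {t..}) \<alpha>"
    unfolding \<alpha>_def by (rule integral_curve_glue[OF \<gamma> flow]) (auto simp: start)
  moreover have "{s..t} \<union> {t..} = {s..}"
    using \<open>s \<le> t\<close> by auto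
  ultimately have \<alpha>: "integral_curve A X {s..} \<alpha>"
    by simp
  define \<delta> where "\<delta> = (\<lambda>u. if u \<in> {s..} then \<alpha> u else \<Phi> (u - s) (\<gamma> s))"
  have "integral_curve A X ({s..} \<union> {..s}) \<delta>"
    unfolding \<delta>_def
    by (rule integral_curve_glue[OF \<alpha> flow]) (use \<open>s \<le> t\<close> in \<open>auto simp: start \<alpha>_def\<close>)
  moreover have "{s..} \<union> {..s} = UNIV"
    by auto
  ultimately have "integral_curve A X UNIV \<delta>"
    by simp
  then show thesis
    by (rule that) (simp add: \<delta>_def \<alpha>_def)
qed

section \<open>Trajectories and positive orbits\<close>

text \<open>
  Integral curves are defined by testing against smooth functions. That they are continuous for the
  topology of the manifold is read off from the geodesic that they run along.
\<close>

lemma minimal_geodesic_to_continuous: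
  assumes "minimal_geodesic_to A D g \<gamma> s a"
  shows "continuous_on {s..} \<gamma>"
proof -
  obtain c \<theta> where c: "minimal_geodesic A D g (\<gamma> s) a c"
    and \<theta>: "continuous_on {s..} \<theta>" "\<theta> ` {s..} = {0..<1}" and eq: "\<forall>t\<ge>s. \<gamma> t = c (\<theta> t)"
    using assms unfolding minimal_geodesic_to_def by blast
  obtain \<epsilon> where "\<epsilon> > 0" and "continuous_on {-\<epsilon><..<1 + \<epsilon>} c"
    using c by (auto simp: minimal_geodesic_def geodesic_on_def)
  then have "continuous_on (\<theta> ` {s..}) c"
    unfolding \<theta> by (auto elim: continuous_on_subset)
  with \<theta> have "continuous_on {s..} (c \<circ> \<theta>)"
    by (intro continuous_on_compose)
  then show ?thesis
    by (rule continuous_on_eq) (simp add: eq)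
qed

lemma minimal_geodesic_to_stays:
  assumes "minimal_geodesic_to A D g \<gamma> s a" and "geodesically_convex A D g C"
    and "\<gamma> s \<in> C" and "a \<in> C" and "s \<le> t"
  shows "\<gamma> t \<in> C"
proof -
  obtain c \<theta> where c: "minimal_geodesic A D g (\<gamma> s) a c"
    and \<theta>: "\<theta> ` {s..} = {0..<1}" and eq: "\<forall>t\<ge>s. \<gamma> t = c (\<theta> t)"
    using assms(1) unfolding minimal_geodesic_to_def by blast
  have "c ` {0..1} \<subseteq> C"
    using assms c unfolding geodesically_convex_def by blast
  moreover have "\<theta> t \<in> {0..1}"
    using \<theta> \<open>s \<le> t\<close> by fastforce
  ultimately show ?thesis
    using eq \<open>s \<le> t\<close> by blast
qed

lemma trajectory_single:
  assumes "X \<in> \<Gamma>" and "T \<ge> 0" and "continuous_on {0..T} \<gamma>" and "integral_curve A X {0..T} \<gamma>"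
  shows "trajectory A \<Gamma> T \<gamma>"
proof -
  have "\<exists>(N::nat) \<tau>. \<tau> 0 = 0 \<and> \<tau> N = T \<and>
      (\<forall>i<N. \<tau> i < \<tau> (Suc i) \<and> (\<exists>X\<in>\<Gamma>. integral_curve A X {\<tau> i..\<tau> (Suc i)} \<gamma>))"
  proof (cases "T = 0")
    \<comment> \<open>The pieces of a partition are nondegenerate, so \<open>T = 0\<close> calls for the empty partition.\<close>
    case True
    then show ?thesis
      by (intro exI[of _ 0] exI[of _ "\<lambda>_. 0"]) simp
  next
    case False
    with assms show ?thesis
      by (intro exI[of _ 1] exI[of _ "\<lambda>i. if i = 0 then 0 else T"]) auto
  qed
  with assms show ?thesis
    by (simp add: trajectory_def)
qed

lemma trajectory_stays:
  assumes traj: "trajectory A \<Gamma> T \<gamma>" and "\<gamma> 0 \<in> C"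
    and pieces: "\<And>X s t. X \<in> \<Gamma> \<Longrightarrow> s \<le> t \<Longrightarrow> integral_curve A X {s..t} \<gamma> \<Longrightarrow> \<gamma> s \<in> C \<Longrightarrow> \<gamma> t \<in> C"
  shows "\<gamma> T \<in> C"
proof -
  obtain N \<tau> where \<tau>: "\<tau> 0 = 0" "\<tau> N = T"
    and step: "\<forall>i<N. \<tau> i < \<tau> (Suc i) \<and> (\<exists>X\<in>\<Gamma>. integral_curve A X {\<tau> i..\<tau> (Suc i)} \<gamma>)"
    using traj unfolding trajectory_def by blast
  have "i \<le> N \<Longrightarrow> \<gamma> (\<tau> i) \<in> C" for i
  proof (induction i)
    case 0
    show ?case using \<tau> \<open>\<gamma> 0 \<in> C\<close> by simp
  next
    case (Suc i)
    then show ?case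
      using step pieces by (meson Suc_le_lessD less_imp_le)
  qed
  then show ?thesis
    using \<tau> by blast
qed

lemma viable_if_zero:
  assumes "\<And>x. x \<in> C \<Longrightarrow> \<exists>X\<in>\<Gamma>. at_point X x = (\<lambda>_. 0)"
  shows "viable A \<Gamma> C"
  unfolding viable_def
proof
  fix x assume "x \<in> C"
  then obtain X where "X \<in> \<Gamma>" and "at_point X x = (\<lambda>_. 0)"
    using assms by blast
  then have "\<forall>T\<ge>0. trajectory A \<Gamma> T (\<lambda>_. x)"
    using trajectory_single integral_curve_const continuous_on_const by metis
  then show "\<exists>\<gamma>. \<gamma> 0 = x \<and> (\<forall>T\<ge>0. trajectory A \<Gamma> T \<gamma>) \<and> (\<forall>t\<ge>0. \<gamma> t \<in> C)"
    using \<open>x \<in> C\<close> by (intro exI[of _ "\<lambda>_. x"]) simp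
qed

lemma attractor_in_closure_orbit:
  assumes "X \<in> \<Gamma>" and "complete_vf A X" and "attractor A X a"
    and cont: "\<And>\<gamma>. integral_curve A X UNIV \<gamma> \<Longrightarrow> continuous_on {0..} \<gamma>"
  shows "a \<in> closure (positive_orbit A \<Gamma> x)"
proof -
  obtain \<Phi> where \<Phi>: "global_flow A X \<Phi>"
    using assms by (auto simp: complete_vf_def)
  then have start: "\<Phi> 0 x = x" and curve: "integral_curve A X UNIV (\<lambda>t. \<Phi> t x)"
    by (auto simp: global_flow_def)
  have "\<Phi> t x \<in> positive_orbit A \<Gamma> x" if "t \<ge> 0" for t
  proof -
    have "continuous_on {0..t} (\<lambda>t. \<Phi> t x)"
      using cont[OF curve] by (rule continuous_on_subset) auto
    then have "trajectory A \<Gamma> t (\<lambda>t. \<Phi> t x)"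
      using trajectory_single assms(1) that integral_curve_subset[OF curve subset_UNIV] by blast
    then show ?thesis
      using start by (auto simp: positive_orbit_def)
  qed
  then have "\<forall>\<^sub>F t in at_top. \<Phi> t x \<in> closure (positive_orbit A \<Gamma> x)"
    by (intro eventually_mono[OF eventually_ge_at_top[of 0]] subsetD[OF closure_subset])
  moreover have "((\<lambda>t. \<Phi> t x) \<longlongrightarrow> a) at_top"
    using assms(3) \<Phi> by (simp add: attractor_def)
  ultimately show ?thesis
    by (intro Lim_in_closed_set[OF closed_closure]) auto
qed

section \<open>The set of attractors\<close>

text \<open>
  Density of orbits pins down the closure of any competitor \<open>C' \<supseteq> C\<close> at a point of \<open>C\<close>, where it
  is the closure of \<open>C\<close> itself; so for closed sets maximality is automatic.
\<close>

lemma invariant_control_set_if_closed: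
  assumes "C \<noteq> {}" and "closed C" and "viable A \<Gamma> C" and dense: "orbit_dense A \<Gamma> C"
  shows "invariant_control_set A \<Gamma> C"
proof -
  have "C' = C" if "C \<subseteq> C'" "orbit_dense A \<Gamma> C'" for C'
  proof -
    obtain x where "x \<in> C"
      using \<open>C \<noteq> {}\<close> by blast
    with that dense have "closure C' = closure C"
      unfolding orbit_dense_def by blast
    then show ?thesis
      using \<open>C \<subseteq> C'\<close> \<open>closed C\<close> closure_subset[of C'] by simp
  qed
  with assms show ?thesis
    unfolding invariant_control_set_def by blast
qed

theorem theorem3p1:
  fixes A :: "('m::{t2_space, second_countable_topology}, 'e::euclidean_space) atlas"
    and D :: "'m vfield \<Rightarrow> 'm vfield \<Rightarrow> 'm vfield"
    and g :: "'m \<Rightarrow> 'm tvec \<Rightarrow> 'm tvec \<Rightarrow> real"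
    and \<Gamma> :: "'m vfield set"
    and E :: "'m set"
  assumes manifold: "smooth_manifold A"
    and connection: "affine_connection A D"
    and metric: "riemannian_metric A g"
    and nonempty: "\<Gamma> \<noteq> {}"
    and fields: "\<And>X. X \<in> \<Gamma> \<Longrightarrow> vector_field A X \<and> complete_vf A X"
    and pregeodesic: "\<And>X. X \<in> \<Gamma> \<Longrightarrow> \<exists>c. smooth_fun A c \<and> D X X = vf_scale c X"
    and attractor: "\<And>X. X \<in> \<Gamma> \<Longrightarrow> \<exists>!a. attractor A X a"
    and minimal: "\<And>X a \<gamma> s. X \<in> \<Gamma> \<Longrightarrow> attractor A X a \<Longrightarrow> integral_curve A X UNIV \<gamma> \<Longrightarrow>
                    minimal_geodesic_to A D g \<gamma> s a"
    and E_def: "E = {a. \<exists>X\<in>\<Gamma>. attractor A X a}"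
    and closed: "closed E"
    and convex: "geodesically_convex A D g E"
  shows "invariant_control_set A \<Gamma> E"
proof (rule invariant_control_set_if_closed[OF _ closed])
  show "E \<noteq> {}"
    using nonempty attractor unfolding E_def by blast
  show "viable A \<Gamma> E"
    by (rule viable_if_zero) (auto simp: E_def attractor_def)
  have stays: "\<gamma> t \<in> E"
    if piece: "X \<in> \<Gamma>" "s \<le> t" "integral_curve A X {s..t} \<gamma>" "\<gamma> s \<in> E" for X s t \<gamma>
  proof -
    obtain \<delta> where \<delta>: "integral_curve A X UNIV \<delta>" "\<And>u. u \<in> {s..t} \<Longrightarrow> \<delta> u = \<gamma> u"
      using integral_curve_extend[OF _ piece(3,2)] fields[OF piece(1)] by blast
    obtain a where a: "attractor A X a"
      using attractor[OF \<open>X \<in> \<Gamma>\<close>] by blast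
    then have "a \<in> E"
      using \<open>X \<in> \<Gamma>\<close> by (auto simp: E_def)
    moreover have "minimal_geodesic_to A D g \<delta> s a"
      using minimal[OF \<open>X \<in> \<Gamma>\<close> a \<delta>(1)] .
    ultimately have "\<delta> t \<in> E"
      using minimal_geodesic_to_stays[OF _ convex] \<delta>(2)[of s] piece by simp
    then show ?thesis
      using \<delta>(2)[of t] piece by simp
  qed
  have sub: "positive_orbit A \<Gamma> x \<subseteq> E" if "x \<in> E" for x
  proof
    fix y assume "y \<in> positive_orbit A \<Gamma> x"
    then obtain \<gamma> T where "trajectory A \<Gamma> T \<gamma>" "\<gamma> 0 = x" "y = \<gamma> T"
      by (auto simp: positive_orbit_def)
    with \<open>x \<in> E\<close> show "y \<in> E"
      using trajectory_stays[of A \<Gamma> T \<gamma> E] stays by simp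
  qed
  have sup: "E \<subseteq> closure (positive_orbit A \<Gamma> x)" for x
  proof
    fix a assume "a \<in> E"
    then obtain X where X: "X \<in> \<Gamma>" "attractor A X a"
      by (auto simp: E_def)
    show "a \<in> closure (positive_orbit A \<Gamma> x)"
    proof (rule attractor_in_closure_orbit[OF \<open>X \<in> \<Gamma>\<close> _ X(2)])
      show "complete_vf A X"
        using fields[OF X(1)] by simp
      show "continuous_on {0..} \<gamma>" if "integral_curve A X UNIV \<gamma>" for \<gamma>
        using minimal[OF X that] by (rule minimal_geodesic_to_continuous)
    qed
  qed
  show "orbit_dense A \<Gamma> E"
    unfolding orbit_dense_def
  proof
    fix x assume "x \<in> E"
    from closure_mono[OF sub[OF this]] closure_minimal[OF sup[of x] closed_closure]
    show "closure E = closure (positive_orbit A \<Gamma> x)"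
      by (rule subset_antisym[rotated])
  qed
qed

end
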